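(* Let $k\ge 2$ be an integer, $\alpha\in(0,1]$ and $n\ge1$. There exists a function $f\in\Sigma(n,k,\alpha)$ which is not a sum of squares of fewer than $2^{n-1}\left(\frac{k}{k+n}\right)^{n/2}$ functions in $C^{\frac{k+\alpha}{2}}(\mathbb{R}^n)$, i.e. $\ell(f)\ge 2^{n-1}\left(\frac{k}{k+n}\right)^{n/2}$. Consequently $$m(n,k,\alpha)\ \ge\ 2^{n-1}\left(\frac{k}{k+n}\right)^{\frac n2}.$$
   Context: For a domain $\Omega\subseteq\mathbb{R}^n$ and $\alpha\in(0,1]$, $C^\alpha(\Omega)$ is the space of functions $f:\Omega\to\mathbb{R}$ with $[f]_{\alpha,\Omega}=\sup_{x\ne y\in\Omega}|f(x)-f(y)|/|x-y|^\alpha<\infty$. $C^{k,\alpha}(\Omega)$ is the space of $k$-times continuously differentiable $f:\Omega\to\mathbb{R}$ with $[\partial^\beta f]_{\alpha,\Omega}<\infty$ for every multi-index $\beta$ with $|\beta|=k$ (no boundedness of $f$ or of its derivatives is required); $C^{0,\alpha}=C^\alpha$. The half-regular space is $C^{\frac{k+\alpha}{2}}(\mathbb{R}^n)=C^{\frac k2,\frac\alpha2}(\mathbb{R}^n)$ if $k$ is even and $C^{\frac{k-1}{2},\frac{1+\alpha}{2}}(\mathbb{R}^n)$ if $k$ is odd. $\Sigma(n,k,\alpha)$ is the set of $f\in C^{k,\alpha}(\mathbb{R}^n)$ that can be written $f=\sum_{j=1}^s g_j^2$ with $s<\infty$ and $g_j\in C^{\frac{k+\alpha}{2}}(\mathbb{R}^n)$;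 the length $\ell(f)$ of $f\in\Sigma(n,k,\alpha)$ is the smallest such $s$; and $m(n,k,\alpha)=\sup\{\ell(f): f\in\Sigma(n,k,\alpha)\}$ (possibly $+\infty$). *)

theory Defs
  imports "HOL-Analysis.Analysis"
begin

definition holder_seminorm :: "real \<Rightarrow> (real^'n) set \<Rightarrow> (real^'n \<Rightarrow> real) \<Rightarrow> ennreal" where
  "holder_seminorm \<alpha> \<Omega> f =
     (SUP (x, y) \<in> {(x, y). x \<in> \<Omega> \<and> y \<in> \<Omega> \<and> x \<noteq> y}.
        ennreal (\<bar>f x - f y\<bar> / norm (x - y) powr \<alpha>))"

definition partial_deriv :: "'n \<Rightarrow> (real^'n \<Rightarrow> real) \<Rightarrow> real^'n \<Rightarrow> real" where
  "partial_deriv i f x = deriv (\<lambda>t. f (x + t *\<^sub>R axis i 1)) 0"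

text \<open>The domain \<open>\<Omega>\<close> is meant to be open.\<close>

primrec cont_diff :: "nat \<Rightarrow> (real^'n) set \<Rightarrow> (real^'n \<Rightarrow> real) \<Rightarrow> bool" where
  "cont_diff 0 \<Omega> f \<longleftrightarrow> continuous_on \<Omega> f"
| "cont_diff (Suc k) \<Omega> f \<longleftrightarrow>
     f differentiable_on \<Omega> \<and> (\<forall>i. cont_diff k \<Omega> (partial_deriv i f))"

text \<open>A multi-index \<open>\<beta>\<close> with \<open>|\<beta>| = k\<close> is represented by a list of \<open>k\<close> coordinates in which
  \<open>i\<close> occurs \<open>\<beta>\<^sub>i\<close> times; on \<open>k\<close> times continuously differentiable functions the order of
  the list does not matter.\<close>

definition holder_space :: "nat \<Rightarrow> real \<Rightarrow> (real^'n) set \<Rightarrow> (real^'n \<Rightarrow> real) set" where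
  "holder_space k \<alpha> \<Omega> =
     {f. cont_diff k \<Omega> f \<and>
         (\<forall>\<beta>. length \<beta> = k \<longrightarrow> holder_seminorm \<alpha> \<Omega> (foldr partial_deriv \<beta> f) < \<infinity>)}"

definition half_regular_space :: "nat \<Rightarrow> real \<Rightarrow> (real^'n \<Rightarrow> real) set" where
  "half_regular_space k \<alpha> =
     (if even k then holder_space (k div 2) (\<alpha> / 2) UNIV
      else holder_space ((k - 1) div 2) ((1 + \<alpha>) / 2) UNIV)"

definition is_sum_of_squares :: "nat \<Rightarrow> real \<Rightarrow> nat \<Rightarrow> (real^'n \<Rightarrow> real) \<Rightarrow> bool" where
  "is_sum_of_squares k \<alpha> s f \<longleftrightarrow>
     (\<exists>g. (\<forall>j\<in>{1..s}. g j \<in> half_regular_space k \<alpha>) \<and> (\<forall>x. f x = (\<Sum>j=1..s. (g j x)\<^sup>2)))"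

definition sos_set :: "nat \<Rightarrow> real \<Rightarrow> (real^'n \<Rightarrow> real) set" where
  "sos_set k \<alpha> = {f \<in> holder_space k \<alpha> UNIV. \<exists>s. is_sum_of_squares k \<alpha> s f}"

definition sos_length :: "nat \<Rightarrow> real \<Rightarrow> (real^'n \<Rightarrow> real) \<Rightarrow> nat" where
  "sos_length k \<alpha> f = (LEAST s. is_sum_of_squares k \<alpha> s f)"

text \<open>The dimension \<open>n\<close> is passed as an index type with \<open>n\<close> elements.\<close>

definition max_sos_length :: "'n::finite itself \<Rightarrow> nat \<Rightarrow> real \<Rightarrow> enat" where
  "max_sos_length _ k \<alpha> = (SUP f \<in> (sos_set k \<alpha> :: (real^'n \<Rightarrow> real) set). enat (sos_length k \<alpha> f))"

definition sos_lower_bound :: "nat \<Rightarrow> nat \<Rightarrow> real" where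
  "sos_lower_bound n k = 2 ^ (n - 1) * (real k / real (k + n)) powr (real n / 2)"

end

theory Submission
  imports Defs "HOL-Computational_Algebra.Polynomial"
begin

text \<open>Put \<open>d = \<lfloor>k/2\<rfloor>\<close> and let \<open>f\<close> be a form of degree \<open>2d\<close>. If \<open>f = \<Sum> g\<^sub>j\<^sup>2\<close> with \<open>g\<^sub>j\<close> of class
  \<open>C\<^sup>d\<close>, then \<open>g\<^sub>j\<close> vanishes to order \<open>d\<close> at the origin, and its Taylor term of degree \<open>d\<close> is a form
  \<open>P\<^sub>j\<close>; rescaling gives \<open>f = \<Sum> P\<^sub>j\<^sup>2\<close>. Sums of \<open>s\<close> squares of forms of degree \<open>d\<close> are parametrised by
  \<open>s M\<close> real coefficients, where \<open>M\<close> is the number of monomials of degree \<open>d\<close>, while the sums of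
  squares contain a cube of dimension \<open>N\<close>, the number of monomials of degree \<open>2d\<close>. Hence \<open>s M < N\<close>
  squares do not suffice for some \<open>f\<close> in this cube, and an elementary estimate bounds \<open>N / M\<close> from
  below by \<open>2\<^sup>n\<^sup>-\<^sup>1 (k/(k+n))\<^sup>n\<^sup>/\<^sup>2\<close>.\<close>

subsection \<open>The binomial estimate\<close>

text \<open>Telescoping: raising every factor of prod (x + j) by one replaces the first factor x by
  x + m. In the binomial estimate this turns the square \<open>A\<^sup>2\<close> into products of
  neighbouring factors.\<close>

lemma prod_consecutive_square:
  fixes x :: real
  shows "(\<Prod>j<m. x + real j)\<^sup>2 * (x + real m) = x * (\<Prod>j<m. (x + real j) * (x + real j + 1))"
proof (induction m)
  case (Suc m)
  have "(\<Prod>j<Suc m. x + real j)\<^sup>2 * (x + real (Suc m))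
      = ((\<Prod>j<m. x + real j)\<^sup>2 * (x + real m)) * ((x + real m) * (x + real m + 1))"
    by (simp add: power2_eq_square mult_ac add_ac)
  also have "\<dots> = x * (\<Prod>j<Suc m. (x + real j) * (x + real j + 1))"
    unfolding Suc.IH by (simp add: mult_ac)
  finally show ?case .
qed simp

text \<open>Pair factor j with factor m - 1 - j. Each pair has sum 2 (x + m), so its product is at
  most (x + m)^2 by the arithmetic-geometric mean inequality; the square of the product runs over
  all these pairs.\<close>

lemma prod_odd_shifts_le:
  fixes x :: real
  assumes "x \<ge> 0"
  shows "(\<Prod>j<m. x + 2 * real j + 1) \<le> (x + real m) ^ m"
proof -
  let ?Q = "\<Prod>j<m. x + 2 * real j + 1"
  have flip: "?Q = (\<Prod>j<m. x + 2 * real (m - Suc j) + 1)"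
    by (rule prod.nat_diff_reindex[symmetric])
  have "?Q\<^sup>2 = (\<Prod>j<m. (x + 2 * real j + 1) * (x + 2 * real (m - Suc j) + 1))"
    unfolding power2_eq_square by (subst (2) flip) (simp add: prod.distrib)
  also have "\<dots> \<le> (\<Prod>j<m. (x + real m)\<^sup>2)"
  proof (rule prod_mono)
    fix j assume "j \<in> {..<m}"
    then have e: "real (m - Suc j) = real m - real j - 1" by (simp add: of_nat_diff)
    have "(x + real m)\<^sup>2 - (x + 2 * real j + 1) * (x + 2 * (real m - real j - 1) + 1)
        = (2 * real j + 1 - real m)\<^sup>2"
      by (simp add: power2_eq_square algebra_simps)
    then show "0 \<le> (x + 2 * real j + 1) * (x + 2 * real (m - Suc j) + 1)
        \<and> (x + 2 * real j + 1) * (x + 2 * real (m - Suc j) + 1) \<le> (x + real m)\<^sup>2"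
      using assms zero_le_power2[of "2 * real j + 1 - real m"] unfolding e[symmetric]
      by (intro conjI mult_nonneg_nonneg) linarith+
  qed
  also have "\<dots> = ((x + real m) ^ m)\<^sup>2"
    by (simp add: power_mult[symmetric] mult.commute)
  finally show ?thesis
    by (rule power2_le_imp_le) (use assms in simp)
qed

lemma binomial_fact_prod:
  "real (e + m choose e) * fact m = (\<Prod>j<m. real e + 1 + real j)"
proof -
  have "e + m choose e = (e + m choose m)"
    using binomial_symmetric[of e "e + m"] by simp
  then have "real (e + m choose e) = pochhammer (real e + 1) m / fact m"
    by (simp add: binomial_gbinomial gbinomial_pochhammer')
  then show ?thesis
    by (simp add: pochhammer_prod atLeast0LessThan)
qed

text \<open>With m = n - 1 and x = 2 d + 1, multiplication by m! turns the binomials N and M into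
  products: N m! = \<open>A\<close> and 2^m M m! = \<open>Q\<close>. The claim becomes
  \<open>r powr (n / 2) * Q \<le> A\<close> for r = k / (k + n), which is proved after
  squaring.\<close>

lemma sos_lower_bound_mult_binomial_le:
  fixes d k n :: nat
  assumes "n > 0" "k \<le> 2 * d + 1"
  shows "sos_lower_bound n k * real (d + n - 1 choose d) \<le> real (2 * d + n - 1 choose (2 * d))"
proof -
  define m where "m = n - 1"
  have n: "n = Suc m" using assms by (simp add: m_def)
  define x where "x = 2 * real d + 1"
  have x: "x \<ge> 1" by (simp add: x_def)
  define A where "A = (\<Prod>j<m. x + real j)"
  define Q where "Q = (\<Prod>j<m. x + 2 * real j + 1)"
  have pos: "A \<ge> 0" "Q \<ge> 0" using x by (auto simp: A_def Q_def intro!: prod_nonneg)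
  have N: "real (2 * d + n - 1 choose (2 * d)) * fact m = A"
    using binomial_fact_prod[of "2 * d" m] by (simp add: n A_def x_def)
  have M: "2 ^ m * real (d + n - 1 choose d) * fact m = Q"
  proof -
    have "2 ^ m * (\<Prod>j<m. real d + 1 + real j) = (\<Prod>j<m. 2 * (real d + 1 + real j))"
      using prod.distrib[of "\<lambda>_. 2" "\<lambda>j. real d + 1 + real j" "{..<m}"] by simp
    also have "\<dots> = Q" unfolding Q_def x_def by (intro prod.cong) auto
    finally show ?thesis
      using binomial_fact_prod[of d m] by (simp add: n mult.assoc)
  qed
  \<comment> \<open>The two factors \<open>Q\<close> are estimated differently: x (x + 2 j + 1) <=
    (x + j) (x + j + 1) absorbs x^m into one of them, and the other is at most (x + m)^m.\<close>
  have "x ^ n * Q\<^sup>2 = x * (x ^ m * Q) * Q" by (simp add: n power2_eq_square)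
  also have "\<dots> \<le> x * (\<Prod>j<m. (x + real j) * (x + real j + 1)) * Q"
  proof -
    have "x ^ m * Q = (\<Prod>j<m. x * (x + 2 * real j + 1))"
      by (simp add: Q_def prod.distrib)
    also have "\<dots> \<le> (\<Prod>j<m. (x + real j) * (x + real j + 1))"
      using x by (intro prod_mono) (auto simp: algebra_simps)
    finally show ?thesis
      using x pos by (intro mult_right_mono mult_left_mono) auto
  qed
  also have "\<dots> = A\<^sup>2 * (x + real m) * Q"
    by (simp add: A_def prod_consecutive_square)
  also have "\<dots> \<le> A\<^sup>2 * (x + real m) * (x + real m) ^ m"
    using prod_odd_shifts_le[of x m] x pos by (intro mult_left_mono) (auto simp: Q_def)
  also have "\<dots> = A\<^sup>2 * (x + real m) ^ n" by (simp add: n)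
  also have "\<dots> \<le> A\<^sup>2 * (x + real n) ^ n"
    using x by (intro mult_left_mono power_mono) (auto simp: n)
  finally have main: "(x / (x + real n)) ^ n * Q\<^sup>2 \<le> A\<^sup>2"
    using x by (simp add: power_divide field_simps)
  \<comment> \<open>The function t / (t + n) is increasing and k <= 2 d + 1 = x, so k / (k + n) may
    replace x / (x + n).\<close>
  define r where "r = real k / real (k + n)"
  have r: "0 \<le> r" "r \<le> x / (x + real n)"
  proof -
    have "real k \<le> x" using assms(2) unfolding x_def by linarith
    then have "real k * real n \<le> x * real n" by (intro mult_right_mono) auto
    then show "r \<le> x / (x + real n)" using assms(1) x by (simp add: r_def field_simps)
  qed (simp add: r_def)
  have "(r powr (real n / 2))\<^sup>2 = r ^ n"
    using r(1) assms(1)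
    by (cases "r = 0") (auto simp: powr_realpow[symmetric] powr_powr[symmetric] powr_numeral powr_powr)
  then have "(r powr (real n / 2) * Q)\<^sup>2 = r ^ n * Q\<^sup>2"
    by (simp add: power_mult_distrib)
  also have "\<dots> \<le> (x / (x + real n)) ^ n * Q\<^sup>2"
    using r by (intro mult_right_mono power_mono) auto
  finally have "(r powr (real n / 2) * Q)\<^sup>2 \<le> A\<^sup>2" using main by simp
  then have "r powr (real n / 2) * Q \<le> A"
    by (rule power2_le_imp_le) (rule pos)
  then have "sos_lower_bound n k * real (d + n - 1 choose d) * fact m
      \<le> real (2 * d + n - 1 choose (2 * d)) * fact m"
    unfolding N M[symmetric] by (simp add: sos_lower_bound_def r_def m_def mult_ac)
  then show ?thesis by (simp add: mult_le_cancel_right)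
qed

subsection \<open>Dimension count\<close>

definition exponents :: "nat \<Rightarrow> ('n::finite \<Rightarrow> nat) set" where
  "exponents e = {a. sum a UNIV = e}"

text \<open>An enumeration \<open>h\<close> of the index type reads an exponent vector as a list
  with the same sum, so that the stars-and-bars count of lists applies.\<close>

lemma bij_betw_exponents_lists:
  "\<exists>\<phi>. bij_betw \<phi> (exponents e :: ('n::finite \<Rightarrow> nat) set) {l. length l = CARD('n) \<and> sum_list l = e}"
proof -
  obtain h where h: "bij_betw h {0..<CARD('n)} (UNIV :: 'n set)"
    using ex_bij_betw_nat_finite finite_class.finite_UNIV by blast
  define h' where "h' = inv_into {0..<CARD('n)} h"
  have h': "\<And>i. h' i < CARD('n)" "\<And>i. h (h' i) = i" "\<And>j. j < CARD('n) \<Longrightarrow> h' (h j) = j"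
    using h unfolding h'_def bij_betw_def
    by (metis UNIV_I atLeastLessThan_iff inv_into_into) (metis UNIV_I bij_betw_inv_into_right h, metis atLeastLessThan_iff bij_betw_inv_into_left h le0)
  have "bij_betw (\<lambda>a. map (a \<circ> h) [0..<CARD('n)]) (exponents e :: ('n \<Rightarrow> nat) set)
      {l. length l = CARD('n) \<and> sum_list l = e}"
  proof (rule bij_betwI[where g = "\<lambda>l i. l ! h' i"])
    show "(\<lambda>a. map (a \<circ> h) [0..<CARD('n)]) \<in> (exponents e :: ('n \<Rightarrow> nat) set) \<rightarrow> {l. length l = CARD('n) \<and> sum_list l = e}"
      using sum.reindex_bij_betw[OF h]
      by (auto simp: exponents_def interv_sum_list_conv_sum_set_nat)
    show "(\<lambda>l i. l ! h' i) \<in> {l. length l = CARD('n) \<and> sum_list l = e} \<rightarrow> exponents e"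
    proof
      fix l assume l: "l \<in> {l. length l = CARD('n) \<and> sum_list l = e}"
      have "(\<Sum>i\<in>UNIV. l ! h' i) = (\<Sum>j\<in>{0..<CARD('n)}. l ! h' (h j))"
        by (rule sum.reindex_bij_betw[OF h, symmetric])
      also have "\<dots> = (\<Sum>j\<in>{0..<CARD('n)}. l ! j)" by (intro sum.cong) (auto simp: h')
      also have "\<dots> = e" using l by (auto simp: sum_list_sum_nth)
      finally show "(\<lambda>i. l ! h' i) \<in> exponents e" by (simp add: exponents_def)
    qed
    show "(\<lambda>i. map (x \<circ> h) [0..<CARD('n)] ! h' i) = x" for x :: "'n \<Rightarrow> nat"
      using h' by (auto simp: fun_eq_iff)
    show "map ((\<lambda>i. y ! h' i) \<circ> h) [0..<CARD('n)] = y" if "y \<in> {l. length l = CARD('n) \<and> sum_list l = e}" for y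
      using that h' by (auto intro!: nth_equalityI)
  qed
  then show ?thesis by blast
qed

lemma card_exponents:
  "card (exponents e :: ('n::finite \<Rightarrow> nat) set) = (e + CARD('n) - 1 choose e)"
  using bij_betw_exponents_lists[where 'n = 'n, of e] card_length_sum_list[of "CARD('n)" e]
  by (metis bij_betw_same_card)

lemma card_exponents_pos: "0 < card (exponents e :: ('n::finite \<Rightarrow> nat) set)"
  unfolding card_exponents using zero_less_card_finite[where 'a = 'n] by (intro zero_less_binomial) linarith

lemma exponents_le: "a \<in> exponents e \<Longrightarrow> a i \<le> e"
  unfolding exponents_def by (auto intro!: member_le_sum)

lemma finite_exponents [simp]: "finite (exponents e)"
proof (rule finite_subset)
  show "exponents e \<subseteq> (PiE UNIV (\<lambda>_. {..e}))" by (auto dest: exponents_le)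
qed (auto intro: finite_PiE)

text \<open>Lower a positive entry of \<open>b\<close> by one and induct on d. For d = e this writes
  each monomial of degree 2 d as a product of two monomials of degree d.\<close>

lemma exponents_split:
  assumes "b \<in> exponents (d + e)"
  shows "\<exists>u v. u \<in> exponents d \<and> v \<in> exponents e \<and> b = (\<lambda>i. u i + v i)"
  using assms
proof (induction d arbitrary: b)
  case 0
  then show ?case by (intro exI[of _ "\<lambda>_. 0"] exI[of _ b]) (auto simp: exponents_def)
next
  case (Suc d)
  then have "sum b UNIV > 0" by (auto simp: exponents_def)
  then obtain i where i: "b i > 0" by (metis gr0I not_less_zero sum.neutral)
  define b' where "b' = b(i := b i - 1)"
  have b: "b = (\<lambda>j. b' j + of_bool (j = i))" using i by (auto simp: b'_def fun_eq_iff)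
  have "sum b UNIV = sum b' UNIV + 1" by (subst b) (simp add: sum.distrib)
  then have "b' \<in> exponents (d + e)" using Suc.prems by (simp add: exponents_def)
  from Suc.IH[OF this] obtain u v where uv: "u \<in> exponents d" "v \<in> exponents e" "b' = (\<lambda>i. u i + v i)" by blast
  show ?case
    using uv by (intro exI[of _ "\<lambda>j. u j + of_bool (j = i)"] exI[of _ v])
      (subst b, auto simp: exponents_def sum.distrib)
qed

text \<open>Pigeonhole: rounding \<open>c\<close> to a grid of mesh proportional to \<open>1/L\<close> separates the \<open>L ^ card J\<close>
  grid points of the cube, but leaves only \<open>O(L ^ card I)\<close> values.\<close>

lemma cube_lipschitz_parametrization_card_le:
  fixes c :: "('j \<Rightarrow> real) \<Rightarrow> 'i \<Rightarrow> real"
  assumes fin: "finite I" "finite J"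
    and bd: "\<And>\<theta> i. \<theta> \<in> J \<rightarrow> {0..1} \<Longrightarrow> i \<in> I \<Longrightarrow> \<bar>c \<theta> i\<bar> \<le> R"
    and lip: "\<And>\<theta> \<theta>' \<delta> j. \<theta> \<in> J \<rightarrow> {0..1} \<Longrightarrow> \<theta>' \<in> J \<rightarrow> {0..1} \<Longrightarrow> j \<in> J \<Longrightarrow> 0 \<le> \<delta> \<Longrightarrow>
               (\<And>i. i \<in> I \<Longrightarrow> \<bar>c \<theta> i - c \<theta>' i\<bar> \<le> \<delta>) \<Longrightarrow> \<bar>\<theta> j - \<theta>' j\<bar> \<le> \<Lambda> * \<delta>"
  shows "card J \<le> card I"
proof (rule ccontr)
  assume "\<not> card J \<le> card I"
  then have less: "card I < card J" by simp
  define Z :: int where "Z = \<lceil>\<bar>R\<bar>\<rceil> + 1"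
  define P :: int where "P = \<lceil>\<bar>\<Lambda>\<bar>\<rceil> + 1"
  have Z: "\<bar>R\<bar> \<le> of_int Z" "Z \<ge> 1" and P: "\<bar>\<Lambda>\<bar> < of_int P" "P \<ge> 1"
    unfolding Z_def P_def by linarith+
  \<comment> \<open>Each coordinate takes at most K L rounded values, so the count will read L^card
    J <= (K L)^card I. Since card J exceeds card I, this forces L <= K^card I, which the choice of
    \<open>L\<close> excludes.\<close>
  define K where "K = nat (2 * (Z * P) + 1)"
  define L where "L = K ^ card I + 1"
  have L: "L > 0" by (simp add: L_def)
  \<comment> \<open>The mesh is 1 / (P L) with P strictly above |\<Lambda>|. Values of
    \<open>c\<close> within one mesh width therefore come from parameters closer than 1 / L, the
    spacing of the grid in the cube.\<close>
  define scale where "scale = real_of_int P * real L"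
  have scale: "scale > 0" using P L by (simp add: scale_def)
  define T where "T = J \<rightarrow>\<^sub>E {..<L}"
  define U where "U = I \<rightarrow>\<^sub>E {- (Z * P * int L)..Z * P * int L}"
  define th where "th t j = real (t j) / real L" for t :: "'j \<Rightarrow> nat" and j
  define \<rho> where "\<rho> t = restrict (\<lambda>i. \<lfloor>c (th t) i * scale\<rfloor>) I" for t
  have th: "th t \<in> J \<rightarrow> {0..1}" if "t \<in> T" for t
    using that L by (auto simp: T_def th_def PiE_iff divide_simps dest!: bspec)
  have "\<rho> ` T \<subseteq> U"
  proof (rule image_subsetI)
    fix t assume t: "t \<in> T"
    have "\<lfloor>c (th t) i * scale\<rfloor> \<in> {- (Z * P * int L)..Z * P * int L}" if "i \<in> I" for i
    proof -
      have "\<bar>c (th t) i * scale\<bar> \<le> of_int Z * scale"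
        using bd[OF th[OF t] that] Z scale by (auto simp: abs_mult intro!: mult_right_mono)
      also have "\<dots> = of_int (Z * P * int L)" by (simp add: scale_def)
      finally have "- of_int (Z * P * int L) \<le> c (th t) i * scale" "c (th t) i * scale \<le> of_int (Z * P * int L)"
        by linarith+
      then show ?thesis
        by (auto simp: le_floor_iff floor_le_iff simp del: of_int_mult)
    qed
    then show "\<rho> t \<in> U" by (auto simp: \<rho>_def U_def)
  qed
  moreover have "inj_on \<rho> T"
  proof (rule inj_onI)
    fix t t' assume t: "t \<in> T" "t' \<in> T" and eq: "\<rho> t = \<rho> t'"
    have close: "\<bar>c (th t) i - c (th t') i\<bar> \<le> 1 / scale" if "i \<in> I" for i
    proof -
      have "\<lfloor>c (th t) i * scale\<rfloor> = \<lfloor>c (th t') i * scale\<rfloor>"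
        using fun_cong[OF eq, of i] that by (simp add: \<rho>_def)
      then have "\<bar>c (th t) i * scale - c (th t') i * scale\<bar> \<le> 1" by linarith
      then have "\<bar>c (th t) i - c (th t') i\<bar> * scale \<le> 1"
        using scale by (simp add: abs_mult left_diff_distrib[symmetric])
      then show ?thesis using scale by (simp add: field_simps)
    qed
    have "t j = t' j" if "j \<in> J" for j
    proof -
      have "\<bar>th t j - th t' j\<bar> \<le> \<Lambda> * (1 / scale)"
        using lip[OF th[OF t(1)] th[OF t(2)] that _ close] scale by simp
      also have "\<dots> < of_int P * (1 / scale)"
        using P scale by (intro mult_strict_right_mono) auto
      also have "\<dots> = 1 / real L" using P by (simp add: scale_def)
      finally have "\<bar>real (t j) - real (t' j)\<bar> < 1"
        using L by (simp add: th_def diff_divide_distrib[symmetric] divide_less_cancel)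
      then show ?thesis by linarith
    qed
    then show "t = t'" using t unfolding T_def by (auto intro: PiE_ext)
  qed
  moreover have "finite U" unfolding U_def by (intro finite_PiE fin) auto
  ultimately have "card T \<le> card U" by (metis card_inj_on_le)
  also have "card T = L ^ card J" using fin by (simp add: T_def card_funcsetE)
  also have "card U = nat (2 * (Z * P * int L) + 1) ^ card I"
    using fin by (simp add: U_def card_funcsetE mult_ac)
  also have "\<dots> \<le> (K * L) ^ card I"
  proof (intro power_mono)
    have "2 * (Z * P * int L) + 1 \<le> (2 * (Z * P) + 1) * int L"
      using L by (simp add: algebra_simps)
    also have "\<dots> = int (K * L)" using Z P by (simp add: K_def)
    finally show "nat (2 * (Z * P * int L) + 1) \<le> K * L" by linarith
  qed simp
  finally have le: "L ^ card J \<le> K ^ card I * L ^ card I" by (simp add: power_mult_distrib)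
  have "L ^ card J \<ge> L ^ Suc (card I)" using less L by (intro power_increasing) auto
  then have "L * L ^ card I \<le> K ^ card I * L ^ card I"
    using le unfolding power_Suc by linarith
  then show False using L by (simp add: L_def)
qed

subsection \<open>Coefficients of forms\<close>

definition monomial :: "('n::finite \<Rightarrow> nat) \<Rightarrow> real^'n \<Rightarrow> real" where
  "monomial a x = (\<Prod>i\<in>UNIV. x $ i ^ a i)"

text \<open>Take for \<open>w m y\<close> the coefficient of X^m in the Lagrange basis polynomial at
  the nodes 0, ..., D that equals 1 at y. Interpolation reproduces X^b for b <= D; compare
  coefficients.\<close>

lemma coefficient_weights:
  "\<exists>w :: nat \<Rightarrow> nat \<Rightarrow> real. \<forall>m b. b \<le> D \<longrightarrow> (\<Sum>y\<le>D. w m y * real y ^ b) = of_bool (m = b)"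
proof -
  define L :: "nat \<Rightarrow> real poly" where
    "L y = (\<Prod>z\<in>{..D} - {y}. smult (1 / (real y - real z)) [:- real z, 1:])" for y
  have deg: "degree (L y) \<le> D" if "y \<le> D" for y
  proof -
    have "degree (L y) \<le> (\<Sum>z\<in>{..D} - {y}. 1)"
      unfolding L_def by (rule order_trans[OF degree_prod_sum_le]) (auto intro!: sum_mono)
    then show ?thesis using that by simp
  qed
  have val: "poly (L y) (real x) = of_bool (x = y)" if "x \<le> D" "y \<le> D" for x y
  proof (cases "x = y")
    case False
    then have "(\<Prod>z\<in>{..D} - {y}. poly (smult (1 / (real y - real z)) [:- real z, 1:]) (real x)) = 0"
      using that by (intro prod_zero bexI[of _ x]) auto
    then show ?thesis using False by (simp add: L_def poly_prod)
  qed (auto simp: L_def poly_prod diff_divide_distrib[symmetric] intro!: prod.neutral)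
  have "(\<Sum>y\<le>D. coeff (L y) m * real y ^ b) = of_bool (m = b)" if b: "b \<le> D" for m b
  proof -
    have "(\<Sum>y\<le>D. smult (real y ^ b) (L y)) = monom 1 b"
    proof (rule poly_eqI_degree[where A = "real ` {..D}"])
      fix x assume "x \<in> real ` {..D}"
      then obtain n where n: "x = real n" "n \<le> D" by auto
      have "poly (\<Sum>y\<le>D. smult (real y ^ b) (L y)) x = (\<Sum>y\<le>D. real y ^ b * of_bool (n = y))"
        using n by (simp add: poly_sum val)
      also have "\<dots> = (\<Sum>y\<le>D. if n = y then real y ^ b else 0)"
        by (intro sum.cong) auto
      finally show "poly (\<Sum>y\<le>D. smult (real y ^ b) (L y)) x = poly (monom 1 b) x"
        using n by (simp add: poly_monom)
    next
      have "degree (\<Sum>y\<le>D. smult (real y ^ b) (L y)) \<le> D"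
        using deg by (intro degree_sum_le) (auto intro: order_trans[OF degree_smult_le])
      then show "degree (\<Sum>y\<le>D. smult (real y ^ b) (L y)) < card (real ` {..D})"
        by (simp add: card_image)
      show "degree (monom (1::real) b) < card (real ` {..D})"
        using b by (simp add: card_image degree_monom_eq)
    qed
    then have "coeff (\<Sum>y\<le>D. smult (real y ^ b) (L y)) m = coeff (monom 1 b) m" by simp
    then show ?thesis by (cases "m = b") (auto simp: coeff_sum mult.commute)
  qed
  then show ?thesis by (intro exI[of _ "\<lambda>m y. coeff (L y) m"]) blast
qed

text \<open>A quantitative equivalence of norms on forms of degree e. In degree d it will bound the
  coefficients of the squared forms; in degree 2 d it will recover \<theta> from values of the
  form.\<close>

definition controls_coefficients :: "nat \<Rightarrow> (real^'n::finite) set \<Rightarrow> real \<Rightarrow> bool" where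
  "controls_coefficients e Y C \<longleftrightarrow> finite Y \<and> 0 \<le> C \<and>
     (\<forall>c B. 0 \<le> B \<longrightarrow> (\<forall>y\<in>Y. \<bar>\<Sum>b\<in>exponents e. c b * monomial b y\<bar> \<le> B) \<longrightarrow>
       (\<forall>a\<in>exponents e. \<bar>c a\<bar> \<le> C * B))"

lemma controls_coefficientsD:
  assumes "controls_coefficients e Y C" "0 \<le> B"
    and "\<And>y. y \<in> Y \<Longrightarrow> \<bar>\<Sum>b\<in>exponents e. c b * monomial b y\<bar> \<le> B" "a \<in> exponents e"
  shows "\<bar>c a\<bar> \<le> C * B"
proof -
  have "\<forall>c B. 0 \<le> B \<longrightarrow> (\<forall>y\<in>Y. \<bar>\<Sum>b\<in>exponents e. c b * monomial b y\<bar> \<le> B) \<longrightarrow>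
      (\<forall>a\<in>exponents e. \<bar>c a\<bar> \<le> C * B)"
    using assms(1) unfolding controls_coefficients_def by (elim conjE)
  from spec[OF spec[OF this, of c], of B] show ?thesis
    using assms(2-4) by blast
qed

text \<open>A coefficient is a fixed linear combination of the values at the grid points
  \<open>{0..e}\<^sup>n\<close>, with products of Lagrange weights as coefficients.\<close>

lemma controls_coefficients_exists:
  "\<exists>(Y :: (real^'n::finite) set) C. controls_coefficients e Y C"
proof -
  obtain w :: "nat \<Rightarrow> nat \<Rightarrow> real"
    where w: "\<And>m b. b \<le> e \<Longrightarrow> (\<Sum>y\<le>e. w m y * real y ^ b) = of_bool (m = b)"
    using coefficient_weights by blast
  define G where "G = (UNIV :: 'n set) \<rightarrow>\<^sub>E {..e}"
  define pt :: "('n \<Rightarrow> nat) \<Rightarrow> real^'n" where "pt y = (\<chi> i. real (y i))" for y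
  define W :: "('n \<Rightarrow> nat) \<Rightarrow> ('n \<Rightarrow> nat) \<Rightarrow> real" where "W a y = (\<Prod>i\<in>UNIV. w (a i) (y i))" for a y
  have finG: "finite G" unfolding G_def by (intro finite_PiE) auto
  \<comment> \<open>The sum over the grid factors into one sum per variable, and no exponent in a
    monomial of degree e exceeds e, so the one-variable weights apply.\<close>
  have dual: "(\<Sum>y\<in>G. W a y * monomial b (pt y)) = of_bool (a = b)" if "b \<in> exponents e" for a b
  proof -
    have "(\<Sum>y\<in>G. W a y * monomial b (pt y)) = (\<Sum>y\<in>G. \<Prod>i\<in>UNIV. w (a i) (y i) * real (y i) ^ b i)"
      by (simp add: W_def monomial_def pt_def prod.distrib)
    also have "\<dots> = (\<Prod>i\<in>UNIV. \<Sum>z\<le>e. w (a i) z * real z ^ b i)"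
      unfolding G_def by (rule prod_sum_PiE[symmetric]) auto
    also have "\<dots> = (\<Prod>i\<in>UNIV. of_bool (a i = b i))"
      by (intro prod.cong refl w exponents_le that)
    also have "\<dots> = of_bool (a = b)" by (auto simp: fun_eq_iff)
    finally show ?thesis .
  qed
  define C where "C = (\<Sum>a\<in>exponents e. \<Sum>y\<in>G. \<bar>W a y\<bar>)"
  show ?thesis
    unfolding controls_coefficients_def
  proof (intro exI[of _ "pt ` G"] exI[of _ C] conjI allI impI ballI)
    fix c :: "('n \<Rightarrow> nat) \<Rightarrow> real" and B and a :: "'n \<Rightarrow> nat"
    let ?P = "\<lambda>x. \<Sum>b\<in>exponents e. c b * monomial b x"
    assume B: "0 \<le> B" and bd: "\<forall>y\<in>pt ` G. \<bar>?P y\<bar> \<le> B" and a: "a \<in> exponents e"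
    have "(\<Sum>y\<in>G. W a y * ?P (pt y)) = (\<Sum>b\<in>exponents e. c b * (\<Sum>y\<in>G. W a y * monomial b (pt y)))"
      unfolding sum_distrib_left by (subst sum.swap) (simp add: mult_ac)
    also have "\<dots> = (\<Sum>b\<in>exponents e. if a = b then c b else 0)"
      by (intro sum.cong) (auto simp: dual)
    also have "\<dots> = c a" using a by simp
    finally have "\<bar>c a\<bar> = \<bar>\<Sum>y\<in>G. W a y * ?P (pt y)\<bar>" by simp
    also have "\<dots> \<le> (\<Sum>y\<in>G. \<bar>W a y\<bar> * B)"
      using bd by (intro order_trans[OF sum_abs] sum_mono) (auto simp: abs_mult intro!: mult_left_mono)
    also have "\<dots> = (\<Sum>y\<in>G. \<bar>W a y\<bar>) * B" by (simp add: sum_distrib_right)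
    also have "\<dots> \<le> C * B"
      unfolding C_def using a B
      by (intro mult_right_mono member_le_sum[where f = "\<lambda>a. \<Sum>y\<in>G. \<bar>W a y\<bar>"]) (auto intro!: sum_nonneg)
    finally show "\<bar>c a\<bar> \<le> C * B" .
  qed (auto simp: C_def finG intro!: sum_nonneg)
qed

text \<open>Choose coefficients \<open>c \<theta>\<close> for each \<theta> in the cube. They are
  bounded, since each square is at most the whole form, and \<theta> is a Lipschitz function of
  them, since the form is quadratic in these bounded numbers. The pigeonhole lemma then compares
  dimensions.\<close>

lemma card_exponents_le_if_perturbations_sos:
  fixes F :: "real^'n::finite \<Rightarrow> real"
  assumes rep: "\<And>\<theta>. \<theta> \<in> exponents (2 * d) \<rightarrow> {0..1} \<Longrightarrow>
    \<exists>c. \<forall>x. F x + (\<Sum>b\<in>exponents (2 * d). \<theta> b * monomial b x)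
            = (\<Sum>j<S. (\<Sum>a\<in>exponents d. c j a * monomial a x)\<^sup>2)"
  shows "card (exponents (2 * d) :: ('n \<Rightarrow> nat) set) \<le> S * card (exponents d :: ('n \<Rightarrow> nat) set)"
proof -
  let ?J = "exponents (2 * d) :: ('n \<Rightarrow> nat) set"
  let ?E = "exponents d :: ('n \<Rightarrow> nat) set"
  let ?P = "\<lambda>c j x. \<Sum>a\<in>?E. c j a * monomial a x"
  obtain c where c: "\<And>\<theta> x. \<theta> \<in> ?J \<rightarrow> {0..1} \<Longrightarrow>
      F x + (\<Sum>b\<in>?J. \<theta> b * monomial b x) = (\<Sum>j<S. (?P (c \<theta>) j x)\<^sup>2)"
  proof -
    let ?\<phi> = "\<lambda>\<theta> c. \<forall>x. F x + (\<Sum>b\<in>?J. \<theta> b * monomial b x) = (\<Sum>j<S. (?P c j x)\<^sup>2)"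
    have some: "?\<phi> \<theta> (SOME c. ?\<phi> \<theta> c)" if "\<theta> \<in> ?J \<rightarrow> {0..1}" for \<theta>
      by (rule someI_ex[of "?\<phi> \<theta>"]) (rule rep[OF that])
    show ?thesis
      by (rule that[of "\<lambda>\<theta>. SOME c. ?\<phi> \<theta> c"]) (rule some[THEN spec])
  qed
  obtain Y1 :: "(real^'n) set" and C1 where Y1: "controls_coefficients d Y1 C1"
    using controls_coefficients_exists by blast
  obtain Y2 :: "(real^'n) set" and C2 where Y2: "controls_coefficients (2 * d) Y2 C2"
    using controls_coefficients_exists by blast
  note fin = Y1[unfolded controls_coefficients_def, THEN conjunct1] Y2[unfolded controls_coefficients_def, THEN conjunct1]
  note C1 = Y1[unfolded controls_coefficients_def, THEN conjunct2, THEN conjunct1]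
  \<comment> \<open>\<open>H\<close> majorises all forms of the cube at once, so \<open>B\<close>
    bounds every squared form on \<open>Y1\<close> uniformly in \<theta>.\<close>
  define H where "H x = \<bar>F x\<bar> + (\<Sum>b\<in>?J. \<bar>monomial b x\<bar>)" for x
  have H0: "H x \<ge> 0" for x unfolding H_def by (intro add_nonneg_nonneg sum_nonneg) auto
  define B where "B = sqrt (\<Sum>y\<in>Y1. H y)"
  define R where "R = C1 * B"
  define A where "A y = (\<Sum>a\<in>?E. \<bar>monomial a y\<bar>)" for y :: "real^'n"
  have A0: "A y \<ge> 0" for y unfolding A_def by (intro sum_nonneg) auto
  define A2 where "A2 = (\<Sum>y\<in>Y2. (A y)\<^sup>2)"
  have B0: "B \<ge> 0" unfolding B_def using H0 by (intro real_sqrt_ge_zero sum_nonneg) auto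
  have R0: "R \<ge> 0" unfolding R_def using B0 C1 by simp
  have bd: "\<bar>c \<theta> j a\<bar> \<le> R" if th: "\<theta> \<in> ?J \<rightarrow> {0..1}" and j: "j < S" and a: "a \<in> ?E" for \<theta> j a
  proof -
    have "\<bar>?P (c \<theta>) j y\<bar> \<le> B" if y: "y \<in> Y1" for y
    proof -
    have "(?P (c \<theta>) j y)\<^sup>2 \<le> (\<Sum>j<S. (?P (c \<theta>) j y)\<^sup>2)"
      using j by (intro member_le_sum[where f = "\<lambda>j. (?P (c \<theta>) j y)\<^sup>2"]) auto
    also have "\<dots> = F y + (\<Sum>b\<in>?J. \<theta> b * monomial b y)" using c[OF th] by simp
    also have "\<dots> \<le> H y"
      unfolding H_def
    proof (intro add_mono sum_mono)
      fix b assume "b \<in> ?J"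
      then have "0 \<le> \<theta> b" "\<theta> b \<le> 1" using th by auto
      then have "\<bar>\<theta> b * monomial b y\<bar> \<le> 1 * \<bar>monomial b y\<bar>"
        unfolding abs_mult by (intro mult_right_mono) auto
      then show "\<theta> b * monomial b y \<le> \<bar>monomial b y\<bar>" by simp
    qed auto
    also have "\<dots> \<le> (\<Sum>y\<in>Y1. H y)" using y fin H0 by (intro member_le_sum) auto
    finally show "\<bar>?P (c \<theta>) j y\<bar> \<le> B"
      unfolding B_def by (rule real_le_rsqrt[of "\<bar>_\<bar>", simplified])
    qed
    then show ?thesis
      unfolding R_def by (rule controls_coefficientsD[OF Y1 B0 _ a])
  qed
  have "card ?J \<le> card ({..<S} \<times> ?E)"
  proof (rule cube_lipschitz_parametrization_card_le[where c = "\<lambda>\<theta> (j, a). c \<theta> j a" and R = R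
        and \<Lambda> = "C2 * (real S * (2 * R * A2))"])
    fix \<theta> \<theta>' \<delta> b
    assume th: "\<theta> \<in> ?J \<rightarrow> {0..1}" "\<theta>' \<in> ?J \<rightarrow> {0..1}" and b: "b \<in> ?J" and \<delta>: "(0::real) \<le> \<delta>"
      and close: "\<And>i. i \<in> {..<S} \<times> ?E \<Longrightarrow>
        \<bar>(case i of (j, a) \<Rightarrow> c \<theta> j a) - (case i of (j, a) \<Rightarrow> c \<theta>' j a)\<bar> \<le> \<delta>"
    have PA: "\<bar>?P (c \<theta>) j y\<bar> \<le> R * A y" if "\<theta> \<in> ?J \<rightarrow> {0..1}" "j < S" for \<theta> j y
      unfolding A_def sum_distrib_left
      using bd[OF that] by (intro order_trans[OF sum_abs] sum_mono) (auto simp: abs_mult intro!: mult_right_mono)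
    have PD: "\<bar>?P (c \<theta>) j y - ?P (c \<theta>') j y\<bar> \<le> \<delta> * A y" if "j < S" for j y
      unfolding A_def sum_distrib_left sum_subtractf[symmetric] left_diff_distrib[symmetric]
      using close that by (intro order_trans[OF sum_abs] sum_mono) (force simp: abs_mult intro!: mult_right_mono)
    \<comment> \<open>The form with coefficients \<theta> - \<theta>' is a difference of two sums of
      squares. In u^2 - v^2 = (u - v) (u + v) the first factor is at most \<delta>
      \<open>A y\<close> and the second at most 2 R \<open>A y\<close>. \<open>A2\<close> makes this
      uniform on \<open>Y2\<close>, and \<open>C2\<close> passes to coefficients, which explains the
      Lipschitz constant.\<close>
    have "\<bar>\<Sum>b\<in>?J. (\<theta> b - \<theta>' b) * monomial b y\<bar> \<le> real S * (2 * R * A2 * \<delta>)" if y: "y \<in> Y2" for y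
    proof -
      have "(\<Sum>b\<in>?J. (\<theta> b - \<theta>' b) * monomial b y)
          = (\<Sum>j<S. (?P (c \<theta>) j y)\<^sup>2) - (\<Sum>j<S. (?P (c \<theta>') j y)\<^sup>2)"
        using c[OF th(1), of y] c[OF th(2), of y] by (simp add: left_diff_distrib sum_subtractf)
      also have "\<dots> = (\<Sum>j<S. (?P (c \<theta>) j y - ?P (c \<theta>') j y) * (?P (c \<theta>) j y + ?P (c \<theta>') j y))"
      proof -
        have "u\<^sup>2 - v\<^sup>2 = (u - v) * (u + v)" for u v :: real
          by (simp add: power2_eq_square algebra_simps)
        then show ?thesis by (subst sum_subtractf[symmetric]) (simp only:)
      qed
      also have "\<bar>\<dots>\<bar> \<le> (\<Sum>j<S. (\<delta> * A y) * (2 * R * A y))"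
      proof (intro order_trans[OF sum_abs] sum_mono)
        fix j assume "j \<in> {..<S}"
        then have j: "j < S" by simp
        have "\<bar>?P (c \<theta>) j y + ?P (c \<theta>') j y\<bar> \<le> 2 * R * A y"
          using PA[OF th(1) j, of y] PA[OF th(2) j, of y] by linarith
        then show "\<bar>(?P (c \<theta>) j y - ?P (c \<theta>') j y) * (?P (c \<theta>) j y + ?P (c \<theta>') j y)\<bar> \<le> \<delta> * A y * (2 * R * A y)"
          unfolding abs_mult using PD[OF j, of y] \<delta> A0 by (intro mult_mono) auto
      qed
      also have "\<dots> = real S * (2 * R * (A y)\<^sup>2 * \<delta>)" by (simp add: power2_eq_square)
      also have "\<dots> \<le> real S * (2 * R * A2 * \<delta>)"
      proof -
        have "(A y)\<^sup>2 \<le> A2" unfolding A2_def using y fin by (intro member_le_sum) auto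
        then show ?thesis using R0 \<delta> by (intro mult_left_mono mult_right_mono) auto
      qed
      finally show ?thesis .
    qed
    moreover have "0 \<le> real S * (2 * R * A2 * \<delta>)"
      using R0 \<delta> by (auto simp: A2_def intro!: mult_nonneg_nonneg sum_nonneg)
    ultimately have "\<bar>\<theta> b - \<theta>' b\<bar> \<le> C2 * (real S * (2 * R * A2 * \<delta>))"
      by (intro controls_coefficientsD[OF Y2, where c = "\<lambda>b. \<theta> b - \<theta>' b"] b)
    then show "\<bar>\<theta> b - \<theta>' b\<bar> \<le> C2 * (real S * (2 * R * A2)) * \<delta>" by (simp add: mult_ac)
  qed (use bd in auto)
  then show ?thesis by (simp add: card_cartesian_product)
qed

subsection \<open>Leading Taylor terms\<close>

text \<open>Here \<open>D m\<close> is the m-th derivative of \<open>D 0\<close>. As the lower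
  Taylor coefficients vanish, the Lagrange remainder gives
  \<open>D 0 t / t ^ d = D d \<xi> / fact d\<close> with \<xi> between 0 and t; now \<xi> tends to 0
  and \<open>D d\<close> is continuous there.\<close>

lemma leading_taylor_limit:
  fixes D :: "nat \<Rightarrow> real \<Rightarrow> real"
  assumes deriv: "\<And>m t. m < d \<Longrightarrow> (D m has_real_derivative D (Suc m) t) (at t)"
    and cont: "isCont (D d) 0" and vanish: "\<And>m. m < d \<Longrightarrow> D m 0 = 0"
  shows "((\<lambda>t. D 0 t / t ^ d) \<longlongrightarrow> D d 0 / fact d) (at_right 0)"
proof -
  \<comment> \<open>The bounds on \<xi> are weak so that \<xi> = t can serve for d = 0, which
    \<open>Maclaurin\<close> excludes.\<close>
  have "\<exists>\<xi>. 0 \<le> \<xi> \<and> \<xi> \<le> t \<and> D 0 t / t ^ d = D d \<xi> / fact d" if t: "t > 0" for t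
  proof (cases "d = 0")
    case True
    then show ?thesis using t by (intro exI[of _ t]) auto
  next
    case False
    then obtain \<xi> where \<xi>: "0 < \<xi>" "\<xi> < t"
      "D 0 t = (\<Sum>m<d. (D m 0 / fact m) * t ^ m) + (D d \<xi> / fact d) * t ^ d"
      using Maclaurin[OF t, of d D "D 0"] deriv by blast
    have "(\<Sum>m<d. (D m 0 / fact m) * t ^ m) = 0" by (intro sum.neutral) (auto simp: vanish)
    then show ?thesis using \<xi> t by (intro exI[of _ \<xi>]) auto
  qed
  then obtain \<xi> where \<xi>: "\<And>t. t > 0 \<Longrightarrow> 0 \<le> \<xi> t \<and> \<xi> t \<le> t \<and> D 0 t / t ^ d = D d (\<xi> t) / fact d"
    by metis
  have "(\<xi> \<longlongrightarrow> 0) (at_right 0)"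
  proof (rule tendsto_sandwich)
    show "\<forall>\<^sub>F t in at_right 0. (0::real) \<le> \<xi> t" "\<forall>\<^sub>F t in at_right 0. \<xi> t \<le> t"
      using \<xi> by (auto simp: eventually_at_filter)
  qed (auto intro: tendsto_ident_at)
  then have "((\<lambda>t. D d (\<xi> t) / fact d) \<longlongrightarrow> D d 0 / fact d) (at_right 0)"
    by (intro tendsto_intros isCont_tendsto_compose[OF cont]) auto
  moreover have "\<forall>\<^sub>F t in at_right 0. D d (\<xi> t) / fact d = D 0 t / t ^ d"
    using \<xi> by (auto simp: eventually_at_filter)
  ultimately show ?thesis by (rule Lim_transform_eventually)
qed

text \<open>Strong induction: once the derivatives below order m are zero,
  \<open>D 0 t / t ^ m\<close> tends to \<open>D m 0 / fact m\<close>, while the bound makes it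
  O(t^(d - m)) with d - m > 0.\<close>

lemma derivatives_vanish_if_power_bound:
  fixes D :: "nat \<Rightarrow> real \<Rightarrow> real"
  assumes deriv: "\<And>m t. m < d \<Longrightarrow> (D m has_real_derivative D (Suc m) t) (at t)"
    and bound: "\<And>t. t > 0 \<Longrightarrow> \<bar>D 0 t\<bar> \<le> C * t ^ d"
  shows "m < d \<Longrightarrow> D m 0 = 0"
proof (induction m rule: less_induct)
  case (less m)
  have "((\<lambda>t. D 0 t / t ^ m) \<longlongrightarrow> D m 0 / fact m) (at_right 0)"
    using less deriv by (intro leading_taylor_limit) (auto intro: DERIV_isCont)
  moreover have "((\<lambda>t. D 0 t / t ^ m) \<longlongrightarrow> 0) (at_right 0)"
  proof (rule Lim_null_comparison)
    have "norm (D 0 t / t ^ m) \<le> C * t ^ (d - m)" if "t > 0" for t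
    proof -
      have "t ^ d = t ^ (d - m) * t ^ m" using less.prems by (simp flip: power_add)
      then show ?thesis using bound[OF that] that by (simp add: divide_le_eq mult.assoc)
    qed
    then show "\<forall>\<^sub>F t in at_right 0. norm (D 0 t / t ^ m) \<le> C * t ^ (d - m)"
      by (auto simp: eventually_at_filter)
    have "((\<lambda>t::real. C * t ^ (d - m)) \<longlongrightarrow> C * 0 ^ (d - m)) (at_right 0)"
      by (intro tendsto_intros)
    then show "((\<lambda>t::real. C * t ^ (d - m)) \<longlongrightarrow> 0) (at_right 0)"
      using less.prems by (simp add: power_0_left)
  qed
  ultimately have "D m 0 / fact m = 0"
    by (rule tendsto_unique[rotated]) (rule trivial_limit_at_right_real)
  then show ?case by simp
qed

section \<open>Differentiation along rays\<close>

lemma has_derivative_partial_deriv: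
  fixes g :: "real^'n::finite \<Rightarrow> real"
  assumes "g differentiable (at z)"
  shows "(g has_derivative (\<lambda>v. \<Sum>i\<in>UNIV. v $ i * partial_deriv i g z)) (at z)"
proof -
  obtain g' where g': "(g has_derivative g') (at z)" using assms by (auto simp: differentiable_def)
  interpret g': bounded_linear g' using g' by (rule has_derivative_bounded_linear)
  have "partial_deriv i g z = g' (axis i 1)" for i
  proof -
    have "((\<lambda>t. z + t *\<^sub>R axis i 1) has_derivative (\<lambda>t. t *\<^sub>R axis i 1)) (at 0)"
      by (auto intro!: derivative_eq_intros)
    moreover have "(g has_derivative g') (at (z + 0 *\<^sub>R axis i 1))" using g' by simp
    ultimately have "((\<lambda>t. g (z + t *\<^sub>R axis i 1)) has_derivative (\<lambda>t. g' (t *\<^sub>R axis i 1))) (at 0)"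
      by (rule has_derivative_compose)
    then have "((\<lambda>t. g (z + t *\<^sub>R axis i 1)) has_real_derivative g' (axis i 1)) (at 0)"
      by (simp add: has_field_derivative_def g'.scaleR mult.commute[of _ "g' _"])
    then show ?thesis unfolding partial_deriv_def by (rule DERIV_imp_deriv)
  qed
  moreover have "g' v = (\<Sum>i\<in>UNIV. v $ i * g' (axis i 1))" for v
  proof -
    have "g' v = g' (\<Sum>i\<in>UNIV. v $ i *\<^sub>R axis i 1)"
      using basis_expansion[of v] by (simp add: scalar_mult_eq_scaleR)
    then show ?thesis by (simp add: g'.sum g'.scaleR)
  qed
  ultimately show ?thesis using g' by (metis (no_types, lifting) ext sum.cong)
qed

lemma has_derivative_along_ray:
  fixes g :: "real^'n::finite \<Rightarrow> real"
  assumes "g differentiable (at (t *\<^sub>R x))"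
  shows "((\<lambda>t. g (t *\<^sub>R x)) has_real_derivative (\<Sum>i\<in>UNIV. x $ i * partial_deriv i g (t *\<^sub>R x))) (at t)"
proof -
  have "((\<lambda>t. t *\<^sub>R x) has_derivative (\<lambda>h. h *\<^sub>R x)) (at t)"
    by (auto intro!: derivative_eq_intros)
  from has_derivative_compose[OF this has_derivative_partial_deriv[OF assms]]
  have "((\<lambda>t. g (t *\<^sub>R x)) has_derivative (\<lambda>h. \<Sum>i\<in>UNIV. (h *\<^sub>R x) $ i * partial_deriv i g (t *\<^sub>R x))) (at t)" .
  moreover have "(\<lambda>h. \<Sum>i\<in>UNIV. (h *\<^sub>R x) $ i * partial_deriv i g (t *\<^sub>R x))
      = (*) (\<Sum>i\<in>UNIV. x $ i * partial_deriv i g (t *\<^sub>R x))"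
    by (auto simp: fun_eq_iff sum_distrib_right intro!: sum.cong)
  ultimately show ?thesis by (simp add: has_field_derivative_def)
qed

lemma cont_diff_continuous: "cont_diff k UNIV g \<Longrightarrow> continuous_on UNIV g"
  by (cases k) (auto intro: differentiable_imp_continuous_on)

text \<open>The induction runs from the right end of the list: \<open>foldr\<close> applies the last
  entry first, and \<open>cont_diff\<close> likewise peels off the innermost derivative.\<close>

lemma cont_diff_foldr_partial_deriv:
  "cont_diff k UNIV g \<Longrightarrow> length \<beta> \<le> k \<Longrightarrow> cont_diff (k - length \<beta>) UNIV (foldr partial_deriv \<beta> g)"
proof (induction \<beta> arbitrary: k g rule: rev_induct)
  case (snoc i \<beta>)
  then obtain k' where "k = Suc k'" by (cases k) auto
  then show ?case using snoc by simp
qed simp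

lemma prod_list_eq_monomial:
  "prod_list (map (($) x) \<beta>) = monomial (count_list \<beta>) x"
proof (induction \<beta>)
  case (Cons i \<beta>)
  have "monomial (count_list (i # \<beta>)) x = (\<Prod>j\<in>UNIV. (if j = i then x $ j else 1) * x $ j ^ count_list \<beta> j)"
    unfolding monomial_def by (intro prod.cong) auto
  also have "\<dots> = x $ i * monomial (count_list \<beta>) x"
    unfolding prod.distrib by (simp add: monomial_def)
  finally show ?case unfolding list.map prod_list.Cons Cons ..
qed (simp add: monomial_def)

lemma count_list_in_exponents: "count_list \<beta> \<in> exponents (length \<beta>)"
  unfolding exponents_def using sum_count_set[of \<beta> UNIV] by simp

lemma sum_lists_Suc:
  fixes h :: "'n::finite list \<Rightarrow> real"
  shows "(\<Sum>\<beta> | length \<beta> = Suc m. h \<beta>) = (\<Sum>\<beta> | length \<beta> = m. \<Sum>i\<in>UNIV. h (i # \<beta>))"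
proof -
  have eq: "{\<beta> :: 'n list. length \<beta> = Suc m} = (\<lambda>(\<beta>, i). i # \<beta>) ` ({\<beta>. length \<beta> = m} \<times> UNIV)"
    by (auto simp: length_Suc_conv)
  have "inj_on (\<lambda>(\<beta>, i). i # \<beta>) ({\<beta> :: 'n list. length \<beta> = m} \<times> UNIV)"
    by (auto simp: inj_on_def)
  then show ?thesis
    unfolding eq by (subst sum.reindex) (auto simp: sum.cartesian_product case_prod_beta)
qed

text \<open>On each ray the growth bound, whose constant may depend on x, kills the derivatives of
  order below d at 0. What remains is the Taylor term of degree d, with coefficients common to all
  rays.\<close>

lemma leading_form_limit:
  fixes g :: "real^'n::finite \<Rightarrow> real"
  assumes cd: "cont_diff d UNIV g"
    and bound: "\<And>x. \<exists>C. \<forall>t>0. \<bar>g (t *\<^sub>R x)\<bar> \<le> C * t ^ d"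
  shows "\<exists>c. \<forall>x. ((\<lambda>t. g (t *\<^sub>R x) / t ^ d) \<longlongrightarrow> (\<Sum>a\<in>exponents d. c a * monomial a x)) (at_right 0)"
proof -
  define pd where "pd \<beta> = foldr partial_deriv \<beta> g" for \<beta>
  \<comment> \<open>Grouping the lists of length d by their counts collects all mixed derivatives
    that multiply the same monomial.\<close>
  define c where "c a = (\<Sum>\<beta> | \<beta> \<in> {\<beta>. length \<beta> = d} \<and> count_list \<beta> = a. pd \<beta> 0) / fact d" for a
  have fin: "finite {\<beta> :: 'n list. length \<beta> = m}" for m
    using finite_lists_length_eq[of "UNIV :: 'n set" m] by simp
  have cdp: "cont_diff (d - m) UNIV (pd \<beta>)" if "length \<beta> = m" "m \<le> d" for \<beta> m
    using cont_diff_foldr_partial_deriv[OF cd, of \<beta>] that by (simp add: pd_def)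
  have "((\<lambda>t. g (t *\<^sub>R x) / t ^ d) \<longlongrightarrow> (\<Sum>a\<in>exponents d. c a * monomial a x)) (at_right 0)" for x
  proof -
    \<comment> \<open>The m-th derivative of g along the ray through x, expanded by the chain rule
      over ordered lists of partial derivatives.\<close>
    define D where "D m t = (\<Sum>\<beta> | length \<beta> = m. monomial (count_list \<beta>) x * pd \<beta> (t *\<^sub>R x))" for m t
    have D0: "D 0 t = g (t *\<^sub>R x)" for t
      by (simp add: D_def pd_def monomial_def)
    have deriv: "(D m has_real_derivative D (Suc m) t) (at t)" if "m < d" for m t
    proof -
      have "(pd \<beta>) differentiable (at (t *\<^sub>R x))" if "length \<beta> = m" for \<beta>
      proof -
        obtain e where "d - m = Suc e" using \<open>m < d\<close> by (cases "d - m") auto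
        then have "cont_diff (Suc e) UNIV (pd \<beta>)" using cdp[OF that] \<open>m < d\<close> by simp
        then show ?thesis by (simp add: differentiable_on_def)
      qed
      then have "(D m has_real_derivative (\<Sum>\<beta> | length \<beta> = m. monomial (count_list \<beta>) x *
          (\<Sum>i\<in>UNIV. x $ i * partial_deriv i (pd \<beta>) (t *\<^sub>R x)))) (at t)"
        unfolding D_def by (intro DERIV_sum DERIV_cmult has_derivative_along_ray) auto
      also have "(\<Sum>\<beta> | length \<beta> = m. monomial (count_list \<beta>) x *
          (\<Sum>i\<in>UNIV. x $ i * partial_deriv i (pd \<beta>) (t *\<^sub>R x))) = D (Suc m) t"
        unfolding D_def sum_lists_Suc prod_list_eq_monomial[symmetric]
        by (simp add: pd_def sum_distrib_left mult_ac)
      finally show ?thesis .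
    qed
    obtain C where C: "\<And>t. t > 0 \<Longrightarrow> \<bar>g (t *\<^sub>R x)\<bar> \<le> C * t ^ d" using bound by blast
    have vanish: "D m 0 = 0" if "m < d" for m
      by (rule derivatives_vanish_if_power_bound[of d D C m]) (use deriv C D0 that in auto)
    have cont: "isCont (D d) 0"
      unfolding D_def
    proof (intro continuous_intros)
      fix \<beta> :: "'n list" assume "\<beta> \<in> {\<beta>. length \<beta> = d}"
      then have "continuous_on UNIV (pd \<beta>)" using cdp[of \<beta> d] cont_diff_continuous by auto
      then have "continuous_on UNIV (\<lambda>t::real. pd \<beta> (t *\<^sub>R x))"
        by (rule continuous_on_compose2) (auto intro!: continuous_intros)
      then show "isCont (\<lambda>t. pd \<beta> (t *\<^sub>R x)) 0" by (simp add: continuous_on_eq_continuous_at)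
    qed
    have "D d 0 / fact d = (\<Sum>a\<in>exponents d. c a * monomial a x)"
    proof -
      have "D d 0 = (\<Sum>a\<in>exponents d. \<Sum>\<beta> | \<beta> \<in> {\<beta>. length \<beta> = d} \<and> count_list \<beta> = a.
          monomial (count_list \<beta>) x * pd \<beta> 0)"
        unfolding D_def scaleR_zero_left
        by (rule sum.group[symmetric]) (use fin count_list_in_exponents in auto)
      then show ?thesis
        by (simp add: c_def sum_divide_distrib sum_distrib_left mult_ac)
    qed
    with leading_taylor_limit[of d D, OF deriv cont vanish] show ?thesis by (simp add: D0)
  qed
  then show ?thesis by blast
qed

text \<open>Each squared \<open>g j\<close> is at most F, hence |g j (t x)| <= sqrt (F x) t^d for t
  > 0 and \<open>g j\<close> has a leading form. Division by t^(2 d) turns F (t x) into F x, and the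
  limit t -> 0 replaces each \<open>g j\<close> by its leading form.\<close>

lemma form_sos_of_smooth_sos:
  fixes F :: "real^'n::finite \<Rightarrow> real" and s :: nat
  assumes homog: "\<And>t x. F (t *\<^sub>R x) = t ^ (2 * d) * F x"
    and sos: "\<And>x. F x = (\<Sum>j=1..s. (g j x)\<^sup>2)"
    and cd: "\<And>j. j \<in> {1..s} \<Longrightarrow> cont_diff d UNIV (g j)"
  shows "\<exists>c. \<forall>x. F x = (\<Sum>j=1..s. (\<Sum>a\<in>exponents d. c j a * monomial a x)\<^sup>2)"
proof -
  have "\<bar>g j (t *\<^sub>R x)\<bar> \<le> sqrt (F x) * t ^ d" if "j \<in> {1..s}" "t > 0" for j t x
  proof -
    have "(g j (t *\<^sub>R x))\<^sup>2 \<le> F (t *\<^sub>R x)"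
      unfolding sos using that(1) by (intro member_le_sum[where f = "\<lambda>j. (g j (t *\<^sub>R x))\<^sup>2"]) auto
    then have "\<bar>g j (t *\<^sub>R x)\<bar> \<le> sqrt (t ^ (2 * d) * F x)"
      unfolding homog by (rule real_le_rsqrt[of "\<bar>_\<bar>", simplified])
    then show ?thesis using that
      by (simp add: real_sqrt_mult power_mult power2_eq_square mult.commute power_mult_distrib real_sqrt_abs2)
  qed
  then have "\<exists>c. \<forall>x. ((\<lambda>t. g j (t *\<^sub>R x) / t ^ d) \<longlongrightarrow> (\<Sum>a\<in>exponents d. c a * monomial a x)) (at_right 0)"
    if "j \<in> {1..s}" for j
    using that by (intro leading_form_limit cd) blast+
  then have "\<forall>j\<in>{1..s}. \<exists>c. \<forall>x.
      ((\<lambda>t. g j (t *\<^sub>R x) / t ^ d) \<longlongrightarrow> (\<Sum>a\<in>exponents d. c a * monomial a x)) (at_right 0)" ..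
  from bchoice[OF this] obtain c where c: "\<forall>j\<in>{1..s}. \<forall>x.
      ((\<lambda>t. g j (t *\<^sub>R x) / t ^ d) \<longlongrightarrow> (\<Sum>a\<in>exponents d. c j a * monomial a x)) (at_right 0)" ..
  have "F x = (\<Sum>j=1..s. (\<Sum>a\<in>exponents d. c j a * monomial a x)\<^sup>2)" for x
  proof -
    have "((\<lambda>t. \<Sum>j=1..s. (g j (t *\<^sub>R x) / t ^ d)\<^sup>2) \<longlongrightarrow>
        (\<Sum>j=1..s. (\<Sum>a\<in>exponents d. c j a * monomial a x)\<^sup>2)) (at_right 0)"
      by (intro tendsto_sum tendsto_power c[rule_format])
    moreover have "(\<Sum>j=1..s. (g j (t *\<^sub>R x) / t ^ d)\<^sup>2) = F x" if "t > 0" for t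
    proof -
      have "(\<Sum>j=1..s. (g j (t *\<^sub>R x) / t ^ d)\<^sup>2) = F (t *\<^sub>R x) / t ^ (2 * d)"
        unfolding sos by (simp add: power_divide sum_divide_distrib power_mult[symmetric] mult.commute)
      then show ?thesis using that by (simp add: homog)
    qed
    then have "\<forall>\<^sub>F t in at_right 0. (\<Sum>j=1..s. (g j (t *\<^sub>R x) / t ^ d)\<^sup>2) = F x"
      by (auto simp: eventually_at_filter)
    ultimately have "((\<lambda>t. F x) \<longlongrightarrow> (\<Sum>j=1..s. (\<Sum>a\<in>exponents d. c j a * monomial a x)\<^sup>2)) (at_right (0::real))"
      by (rule Lim_transform_eventually)
    then show ?thesis by (simp add: tendsto_const_iff)
  qed
  then show ?thesis by blast
qed

subsection \<open>Regularity of forms\<close>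

text \<open>Stands for the forms of degree e. Generating them, instead of imposing the scaling law,
  makes smoothness and closure under partial derivatives accessible to rule induction.\<close>

inductive homog :: "nat \<Rightarrow> (real^'n::finite \<Rightarrow> real) \<Rightarrow> bool" where
  homog_const: "homog 0 (\<lambda>x. c)"
| homog_add: "homog e f \<Longrightarrow> homog e g \<Longrightarrow> homog e (\<lambda>x. f x + g x)"
| homog_var_mult: "homog e f \<Longrightarrow> homog (Suc e) (\<lambda>x. x $ i * f x)"

lemma homog_zero: "homog e (\<lambda>x. 0)"
proof (induction e)
  case (Suc e)
  from homog_var_mult[OF this] show ?case by simp
qed (rule homog_const)

lemma homog_cmult: "homog e f \<Longrightarrow> homog e (\<lambda>x. c * f x)"
proof (induction rule: homog.induct)
  case (homog_add e f g)
  then show ?case by (auto simp: distrib_left intro: homog.homog_add)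
next
  case (homog_var_mult e f i)
  from homog.homog_var_mult[OF homog_var_mult.IH, of i] show ?case by (simp add: mult_ac)
qed (rule homog_const)

lemma homog_mult: "homog d f \<Longrightarrow> homog e g \<Longrightarrow> homog (d + e) (\<lambda>x. f x * g x)"
proof (induction rule: homog.induct)
  case (homog_const c)
  then show ?case by (simp add: homog_cmult)
next
  case (homog_add d f h)
  then show ?case by (auto simp: distrib_right intro: homog.homog_add)
next
  case (homog_var_mult d f i)
  then show ?case using homog.homog_var_mult[of "d + e" "\<lambda>x. f x * g x" i] by (simp add: mult.assoc)
qed

lemma homog_sum: "finite T \<Longrightarrow> (\<And>t. t \<in> T \<Longrightarrow> homog e (f t)) \<Longrightarrow> homog e (\<lambda>x. \<Sum>t\<in>T. f t x)"
  by (induction T rule: finite_induct) (auto intro: homog_zero homog_add)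

lemma homog_monomial:
  fixes a :: "'n::finite \<Rightarrow> nat"
  assumes "a \<in> exponents e"
  shows "homog e (monomial a)"
proof -
  have pow: "homog m (\<lambda>x :: real^'n. x $ i ^ m)" for i m
    by (induction m) (auto intro: homog_const homog_var_mult)
  have "homog (sum a A) (\<lambda>x. \<Prod>i\<in>A. x $ i ^ a i)" if "finite A" for A
    using that by (induction A rule: finite_induct) (auto intro: homog_const homog_mult pow)
  from this[of UNIV] show ?thesis using assms unfolding monomial_def[abs_def] exponents_def by simp
qed

lemma homog_scaleR: "homog e f \<Longrightarrow> f (t *\<^sub>R x) = t ^ e * f x"
  by (induction rule: homog.induct) (auto simp: algebra_simps)

lemma homog_differentiable: "homog e f \<Longrightarrow> f differentiable (at x)"
proof (induction rule: homog.induct)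
  case (homog_var_mult e f i)
  have "(\<lambda>x. x $ i) differentiable (at x)"
    by (intro bounded_linear_imp_differentiable bounded_linear_vec_nth)
  then show ?case using homog_var_mult.IH by (rule differentiable_mult)
qed auto

section \<open>Partial derivatives of forms\<close>

lemma has_real_derivative_partial_deriv:
  fixes f :: "real^'n::finite \<Rightarrow> real"
  assumes "f differentiable (at x)"
  shows "((\<lambda>t. f (x + t *\<^sub>R axis i 1)) has_real_derivative partial_deriv i f x) (at 0)"
proof -
  have "(\<lambda>t. x + t *\<^sub>R axis i 1) differentiable (at (0::real))"
    by (auto intro!: derivative_eq_intros simp: differentiable_def)
  moreover have "f differentiable (at (x + 0 *\<^sub>R axis i 1))" using assms by simp
  ultimately have "(\<lambda>t. f (x + t *\<^sub>R axis i 1)) differentiable (at (0::real))"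
    using differentiable_chain_at[of "\<lambda>t. x + t *\<^sub>R axis i 1" 0 f] by (simp add: o_def)
  then show ?thesis
    unfolding partial_deriv_def by (simp add: DERIV_deriv_iff_real_differentiable)
qed

lemma partial_deriv_add:
  assumes "\<And>x. f differentiable (at x)" "\<And>x. g differentiable (at x)"
  shows "partial_deriv i (\<lambda>x. f x + g x) = (\<lambda>x. partial_deriv i f x + partial_deriv i g x)"
  using DERIV_add[OF has_real_derivative_partial_deriv[OF assms(1)] has_real_derivative_partial_deriv[OF assms(2)]]
  by (auto simp: fun_eq_iff partial_deriv_def[of i "\<lambda>x. f x + g x"] intro!: DERIV_imp_deriv)

lemma partial_deriv_var_mult:
  assumes "\<And>x. f differentiable (at x)"
  shows "partial_deriv i (\<lambda>x. x $ j * f x) = (\<lambda>x. of_bool (i = j) * f x + x $ j * partial_deriv i f x)"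
proof
  fix x
  have "((\<lambda>t. (x + t *\<^sub>R axis i 1) $ j) has_real_derivative of_bool (i = j)) (at 0)"
    by (auto simp: axis_def intro!: derivative_eq_intros)
  from DERIV_mult[OF this has_real_derivative_partial_deriv[OF assms]]
  show "partial_deriv i (\<lambda>x. x $ j * f x) x = of_bool (i = j) * f x + x $ j * partial_deriv i f x"
    unfolding partial_deriv_def[of i "\<lambda>x. x $ j * f x"]
    by (intro DERIV_imp_deriv) (simp add: mult_ac add_ac)
qed

text \<open>For e = 0 the truncated degree e - 1 is again 0, hence the second conjunct: in the
  product rule with f of degree 0, the coordinate times the derivative of f must be seen to vanish
  rather than to have degree 1.\<close>

lemma homog_partial_deriv:
  "homog e f \<Longrightarrow> homog (e - 1) (partial_deriv i f) \<and> (e = 0 \<longrightarrow> partial_deriv i f = (\<lambda>x. 0))"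
proof (induction rule: homog.induct)
  case (homog_const c)
  have "partial_deriv i (\<lambda>x. c) = (\<lambda>x. 0)" by (simp add: partial_deriv_def fun_eq_iff)
  then show ?case by (simp add: homog_zero)
next
  case (homog_add e f g)
  then show ?case
    by (auto simp: partial_deriv_add homog_differentiable intro: homog.homog_add)
next
  case (homog_var_mult e f j)
  have "homog e (\<lambda>x. x $ j * partial_deriv i f x)"
  proof (cases e)
    case 0
    then show ?thesis using homog_var_mult.IH by (simp add: homog_zero)
  next
    case (Suc e')
    then show ?thesis using homog_var_mult.IH homog.homog_var_mult[of e' "partial_deriv i f" j] by simp
  qed
  then show ?case
    using homog_var_mult.hyps
    by (simp add: partial_deriv_var_mult homog_differentiable homog.homog_add homog_cmult)
qed

lemma homog_cont_diff: "homog e f \<Longrightarrow> cont_diff k UNIV f"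
proof (induction k arbitrary: e f)
  case 0
  then show ?case
    by (auto intro!: differentiable_imp_continuous_on simp: differentiable_on_def homog_differentiable)
next
  case (Suc k)
  then show ?case
    using homog_partial_deriv[OF Suc.prems] by (auto simp: differentiable_on_def homog_differentiable)
qed

lemma homog_foldr_partial_deriv: "homog e f \<Longrightarrow> homog (e - length \<beta>) (foldr partial_deriv \<beta> f)"
proof (induction \<beta>)
  case (Cons i \<beta>)
  then have "homog (e - length \<beta> - 1) (partial_deriv i (foldr partial_deriv \<beta> f))"
    using homog_partial_deriv by blast
  then show ?case by simp
qed simp

text \<open>A derivative of order k >= e is a form of degree 0, hence constant, with Hoelder
  seminorm 0 for every \<alpha>.\<close>

lemma homog_in_holder_space:
  assumes "homog e f" "e \<le> k"
  shows "f \<in> holder_space k \<alpha> UNIV"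
proof -
  have "holder_seminorm \<alpha> UNIV (foldr partial_deriv \<beta> f) < \<infinity>" if "length \<beta> = k" for \<beta>
  proof -
    have "homog 0 (foldr partial_deriv \<beta> f)"
      using homog_foldr_partial_deriv[OF assms(1), of \<beta>] assms(2) that by simp
    \<comment> \<open>The scaling law at t = 0 in degree 0 involves 0^0 = 1, so the value at x
      equals the value at 0.\<close>
    from homog_scaleR[OF this, of 0] have const: "foldr partial_deriv \<beta> f 0 = foldr partial_deriv \<beta> f x" for x
      by simp
    have "holder_seminorm \<alpha> UNIV (foldr partial_deriv \<beta> f) \<le> 0"
      unfolding holder_seminorm_def
    proof (intro SUP_least, clarify)
      fix x y
      show "ennreal (\<bar>foldr partial_deriv \<beta> f x - foldr partial_deriv \<beta> f y\<bar> / norm (x - y) powr \<alpha>) \<le> 0"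
        unfolding const[of x, symmetric] const[of y, symmetric] by simp
    qed
    then show ?thesis by simp
  qed
  then show ?thesis using assms homog_cont_diff by (auto simp: holder_space_def)
qed

subsection \<open>A form that needs many squares\<close>

text \<open>For odd k, (k - 1) div 2 = k div 2, so d = k div 2 is the order of differentiability in
  both parities.\<close>

lemma half_regular_space_eq:
  "half_regular_space k \<alpha> = holder_space (k div 2) (if even k then \<alpha> / 2 else (1 + \<alpha>) / 2) UNIV"
  unfolding half_regular_space_def by (auto elim!: oddE)

lemma homog_is_sum_of_squares:
  assumes "finite T" "\<And>t. t \<in> T \<Longrightarrow> homog (k div 2) (g t)" "\<And>x. F x = (\<Sum>t\<in>T. (g t x)\<^sup>2)"
  shows "\<exists>s. is_sum_of_squares k \<alpha> s F"
proof -
  obtain h where h: "bij_betw h {1..card T} T"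
    using ex_bij_betw_nat_finite_1[OF assms(1)] by blast
  have "h j \<in> T" if "j \<in> {1..card T}" for j using h that by (auto simp: bij_betw_def)
  moreover have "F x = (\<Sum>j=1..card T. (g (h j) x)\<^sup>2)" for x
    unfolding assms(3) by (rule sum.reindex_bij_betw[OF h, symmetric])
  ultimately have "is_sum_of_squares k \<alpha> (card T) F"
    unfolding is_sum_of_squares_def half_regular_space_eq
    by (intro exI[of _ "\<lambda>j. g (h j)"]) (auto intro!: homog_in_holder_space assms)
  then show ?thesis ..
qed

text \<open>Uses \<open>\<theta> u v = \<theta>/2 (u + v)\<^sup>2 - \<theta>/2 (u\<^sup>2 + v\<^sup>2)\<close>: adding \<open>(u\<^sup>2 + v\<^sup>2)/2\<close> makes this a sum
  of squares for every \<open>\<theta>\<close> in \<open>[0,1]\<close>.\<close>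

lemma sos_cube_exists:
  fixes k :: nat
  defines "d \<equiv> k div 2"
  shows "\<exists>F :: real^'n::finite \<Rightarrow> real. \<forall>\<theta> \<in> exponents (2 * d) \<rightarrow> {0..1}.
    homog (2 * d) (\<lambda>x. F x + (\<Sum>b\<in>exponents (2 * d). \<theta> b * monomial b x)) \<and>
    (\<exists>s. is_sum_of_squares k \<alpha> s (\<lambda>x. F x + (\<Sum>b\<in>exponents (2 * d). \<theta> b * monomial b x)))"
proof -
  let ?J = "exponents (2 * d) :: ('n \<Rightarrow> nat) set"
  have "\<forall>b\<in>?J. \<exists>uv. fst uv \<in> exponents d \<and> snd uv \<in> exponents d \<and> b = (\<lambda>i. fst uv i + snd uv i)"
    using exponents_split[of _ d d] by (auto simp: mult_2)
  from bchoice[OF this] obtain uv where uv: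
    "\<forall>b\<in>?J. fst (uv b) \<in> exponents d \<and> snd (uv b) \<in> exponents d \<and> b = (\<lambda>i. fst (uv b) i + snd (uv b) i)" ..
  define p q where "p b = (monomial (fst (uv b)) :: real^'n \<Rightarrow> real)" and "q b = (monomial (snd (uv b)) :: real^'n \<Rightarrow> real)" for b
  have pq: "homog d (p b)" "homog d (q b)" "monomial b x = p b x * q b x" if b: "b \<in> ?J" for b x
  proof -
    show "homog d (p b)" "homog d (q b)" using uv b by (auto simp: p_def q_def intro!: homog_monomial)
    have "b i = fst (uv b) i + snd (uv b) i" for i using uv b by (metis (no_types, lifting))
    then show "monomial b x = p b x * q b x"
      by (simp add: monomial_def p_def q_def power_add prod.distrib)
  qed
  define F where "F x = (\<Sum>b\<in>?J. ((p b x)\<^sup>2 + (q b x)\<^sup>2) / 2)" for x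
  show ?thesis
  proof (intro exI[of _ F] ballI conjI)
    fix \<theta> :: "('n \<Rightarrow> nat) \<Rightarrow> real" assume th: "\<theta> \<in> ?J \<rightarrow> {0..1}"
    \<comment> \<open>Three squares for each exponent vector \<open>b\<close>: (p + q)^2 with weight
      \<theta>/2, and p^2 and q^2 each with weight (1 - \<theta>)/2. These weights are nonnegative
      because \<theta> lies in [0, 1].\<close>
    define g where "g = (\<lambda>(b, l :: nat) x. if l = 0 then sqrt (\<theta> b / 2) * (p b x + q b x)
      else if l = 1 then sqrt ((1 - \<theta> b) / 2) * p b x else sqrt ((1 - \<theta> b) / 2) * q b x)"
    let ?F = "\<lambda>x. F x + (\<Sum>b\<in>?J. \<theta> b * monomial b x)"
    have hg: "homog d (g t)" if "t \<in> ?J \<times> {..<3}" for t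
    proof -
      obtain b l where t: "t = (b, l)" "b \<in> ?J" using \<open>t \<in> ?J \<times> {..<3}\<close> by auto
      show ?thesis unfolding t(1) g_def using pq(1,2)[OF t(2)]
        by (cases "l = 0"; cases "l = 1") (auto intro!: homog_cmult homog_add)
    qed
    have sq: "?F x = (\<Sum>t\<in>?J \<times> {..<3}. (g t x)\<^sup>2)" for x
    proof -
      have "(\<Sum>l<3. (g (b, l) x)\<^sup>2) = ((p b x)\<^sup>2 + (q b x)\<^sup>2) / 2 + \<theta> b * monomial b x" if b: "b \<in> ?J" for b
      proof -
        have "0 \<le> \<theta> b" "\<theta> b \<le> 1" using th b by auto
        then have "(\<Sum>l<3. (g (b, l) x)\<^sup>2) = \<theta> b / 2 * (p b x + q b x)\<^sup>2
            + (1 - \<theta> b) / 2 * (p b x)\<^sup>2 + (1 - \<theta> b) / 2 * (q b x)\<^sup>2"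
          by (simp add: g_def numeral_3_eq_3 power_mult_distrib)
        then show ?thesis by (simp add: pq(3)[OF b] power2_eq_square field_simps)
      qed
      then have "?F x = (\<Sum>b\<in>?J. \<Sum>l<3. (g (b, l) x)\<^sup>2)"
        by (simp add: F_def sum.distrib)
      then show ?thesis by (simp add: sum.cartesian_product case_prod_beta)
    qed
    show "\<exists>s. is_sum_of_squares k \<alpha> s ?F"
      using hg sq unfolding d_def by (intro homog_is_sum_of_squares[where g = g and T = "?J \<times> {..<3}"]) (auto simp: d_def)
    have "homog (d + d) (\<lambda>x. \<Sum>t\<in>?J \<times> {..<3}. g t x * g t x)"
      by (intro homog_sum homog_mult hg) auto
    then show "homog (2 * d) ?F" unfolding sq power2_eq_square by (simp add: mult_2)
  qed
qed

text \<open>Otherwise every form of the cube would be a sum of s squares with s M < N, where M and N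
  count the monomials of degrees d and 2 d. Passing to leading forms, the dimension count would give
  N <= S M <= N - 1.\<close>

lemma sos_form_with_many_squares:
  fixes k :: nat
  defines "d \<equiv> k div 2"
  shows "\<exists>f :: real^'n::finite \<Rightarrow> real. homog (2 * d) f \<and> (\<exists>s. is_sum_of_squares k \<alpha> s f) \<and>
    (\<forall>s. s * card (exponents d :: ('n \<Rightarrow> nat) set) < card (exponents (2 * d) :: ('n \<Rightarrow> nat) set)
      \<longrightarrow> \<not> is_sum_of_squares k \<alpha> s f)"
proof (rule ccontr)
  assume contra: "\<not> ?thesis"
  let ?J = "exponents (2 * d) :: ('n \<Rightarrow> nat) set"
  let ?M = "card (exponents d :: ('n \<Rightarrow> nat) set)"
  \<comment> \<open>The largest s with s M < N, so that one number of squares serves the whole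
    cube.\<close>
  define S where "S = (card ?J - 1) div ?M"
  obtain F :: "real^'n \<Rightarrow> real" where F: "\<forall>\<theta> \<in> ?J \<rightarrow> {0..1}.
    homog (2 * d) (\<lambda>x. F x + (\<Sum>b\<in>?J. \<theta> b * monomial b x)) \<and>
    (\<exists>s. is_sum_of_squares k \<alpha> s (\<lambda>x. F x + (\<Sum>b\<in>?J. \<theta> b * monomial b x)))"
    using sos_cube_exists[of k \<alpha>, where 'n = 'n] unfolding d_def ..
  have M: "?M > 0" "card ?J > 0" by (rule card_exponents_pos)+
  have "card ?J \<le> S * ?M"
  proof (rule card_exponents_le_if_perturbations_sos)
    fix \<theta> :: "('n \<Rightarrow> nat) \<Rightarrow> real" assume th: "\<theta> \<in> ?J \<rightarrow> {0..1}"
    let ?F = "\<lambda>x. F x + (\<Sum>b\<in>?J. \<theta> b * monomial b x)"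
    have hF: "homog (2 * d) ?F" and ex: "\<exists>s. is_sum_of_squares k \<alpha> s ?F" using F th by blast+
    with contra obtain s where s: "s * ?M < card ?J" "is_sum_of_squares k \<alpha> s ?F" by blast
    then have "s \<le> S" using M by (auto simp: S_def less_eq_div_iff_mult_less_eq)
    obtain g where g: "\<forall>j\<in>{1..s}. g j \<in> half_regular_space k \<alpha>" "\<forall>x. ?F x = (\<Sum>j=1..s. (g j x)\<^sup>2)"
      using s(2) unfolding is_sum_of_squares_def by blast
    have "\<exists>c. \<forall>x. ?F x = (\<Sum>j=1..s. (\<Sum>a\<in>exponents d. c j a * monomial a x)\<^sup>2)"
    proof (rule form_sos_of_smooth_sos)
      show "?F (t *\<^sub>R x) = t ^ (2 * d) * ?F x" for t x by (rule homog_scaleR[OF hF])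
      show "?F x = (\<Sum>j=1..s. (g j x)\<^sup>2)" for x using g(2) ..
      show "cont_diff d UNIV (g j)" if "j \<in> {1..s}" for j
        using g(1) that by (auto simp: half_regular_space_eq holder_space_def d_def)
    qed
    then obtain c where c: "\<forall>x. ?F x = (\<Sum>j=1..s. (\<Sum>a\<in>exponents d. c j a * monomial a x)\<^sup>2)" ..
    \<comment> \<open>Moves the indices from 1..s to 0..s - 1 and pads with zero forms up to
      \<open>S\<close>, which does not depend on \<theta>.\<close>
    define c' where "c' j a = (if j < s then c (Suc j) a else 0)" for j a
    have "?F x = (\<Sum>j<S. (\<Sum>a\<in>exponents d. c' j a * monomial a x)\<^sup>2)" for x
    proof -
      have "?F x = (\<Sum>j=1..s. (\<Sum>a\<in>exponents d. c j a * monomial a x)\<^sup>2)" using c ..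
      also have "\<dots> = (\<Sum>j<s. (\<Sum>a\<in>exponents d. c (Suc j) a * monomial a x)\<^sup>2)"
        using sum.atLeast1_atMost_eq[of "\<lambda>j. (\<Sum>a\<in>exponents d. c j a * monomial a x)\<^sup>2" s] by simp
      also have "\<dots> = (\<Sum>j<S. (\<Sum>a\<in>exponents d. c' j a * monomial a x)\<^sup>2)"
        using \<open>s \<le> S\<close> by (intro sum.mono_neutral_cong_left) (auto simp: c'_def)
      finally show ?thesis .
    qed
    then show "\<exists>c. \<forall>x. ?F x = (\<Sum>j<S. (\<Sum>a\<in>exponents d. c j a * monomial a x)\<^sup>2)" by blast
  qed
  moreover have "S * ?M \<le> card ?J - 1" unfolding S_def by (rule div_times_less_eq_dividend)
  ultimately show False using M by linarith
qed

theorem theorem2: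
  fixes k :: nat and \<alpha> :: real
  assumes "k \<ge> 2" and "0 < \<alpha>" and "\<alpha> \<le> 1"
  shows "(\<exists>f :: real^'n \<Rightarrow> real. f \<in> sos_set k \<alpha> \<and>
            (\<forall>s. real s < sos_lower_bound CARD('n) k \<longrightarrow> \<not> is_sum_of_squares k \<alpha> s f) \<and>
            real (sos_length k \<alpha> f) \<ge> sos_lower_bound CARD('n) k) \<and>
         ereal_of_enat (max_sos_length TYPE('n) k \<alpha>) \<ge> ereal (sos_lower_bound CARD('n) k)"
proof -
  define d where "d = k div 2"
  define B where "B = sos_lower_bound CARD('n) k"
  obtain f :: "real^'n \<Rightarrow> real" where f: "homog (2 * d) f" "\<exists>s. is_sum_of_squares k \<alpha> s f"
    and lower: "\<And>s. s * card (exponents d :: ('n \<Rightarrow> nat) set) < card (exponents (2 * d) :: ('n \<Rightarrow> nat) set)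
      \<Longrightarrow> \<not> is_sum_of_squares k \<alpha> s f"
    using sos_form_with_many_squares[of k \<alpha>, where 'n = 'n] unfolding d_def by blast
  \<comment> \<open>The degree 2 d is at most k, so the form is regular enough to lie in the Hoelder
    space of order k.\<close>
  have sos: "f \<in> sos_set k \<alpha>"
    using f homog_in_holder_space[of "2 * d" f k \<alpha>] by (auto simp: sos_set_def d_def)
  \<comment> \<open>By the binomial estimate, s < B implies s M < B M <= N.\<close>
  have not_sos: "\<not> is_sum_of_squares k \<alpha> s f" if "real s < B" for s
  proof (rule lower)
    let ?M = "card (exponents d :: ('n \<Rightarrow> nat) set)"
    have "?M > 0" by (rule card_exponents_pos)
    then have "real s * real ?M < B * real ?M" using that by simp
    also have "\<dots> \<le> real (card (exponents (2 * d) :: ('n \<Rightarrow> nat) set))"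
      unfolding B_def card_exponents by (rule sos_lower_bound_mult_binomial_le) (auto simp: d_def)
    finally show "s * ?M < card (exponents (2 * d) :: ('n \<Rightarrow> nat) set)"
      by (metis of_nat_less_iff of_nat_mult)
  qed
  \<comment> \<open>A representation exists, so the minimum defining the length is attained and
    cannot lie below \<open>B\<close>.\<close>
  have "is_sum_of_squares k \<alpha> (sos_length k \<alpha> f) f"
    using f(2) unfolding sos_length_def by (rule LeastI_ex)
  then have len: "real (sos_length k \<alpha> f) \<ge> B"
    using not_sos by (meson not_le)
  have "enat (sos_length k \<alpha> f) \<le> max_sos_length TYPE('n) k \<alpha>"
    unfolding max_sos_length_def using sos by (rule SUP_upper)
  then have "ereal_of_enat (enat (sos_length k \<alpha> f)) \<le> ereal_of_enat (max_sos_length TYPE('n) k \<alpha>)"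
    by (simp only: ereal_of_enat_le_iff)
  moreover have "ereal B \<le> ereal_of_enat (enat (sos_length k \<alpha> f))" using len by simp
  ultimately have "ereal B \<le> ereal_of_enat (max_sos_length TYPE('n) k \<alpha>)" by (rule order_trans[rotated])
  then show ?thesis using sos not_sos len unfolding B_def by blast
qed

end
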